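(* Let $G$ be a connected $d$-regular simple graph on $n$ vertices with $d>\frac{n}{2}-1$. Let $L$ be its Laplacian, $L^{\dagger}$ the Moore–Penrose pseudo-inverse of $L$, $f=\max_{i} L^{\dagger}_{ii}$ and $o=\max_{i\neq j}|L^{\dagger}_{ij}|$. Then $$ o \leq \frac{f}{2d-n+3}+\frac{2}{n^2}.$$
   Context: The Laplacian $L$ has $L_{ii}=d$, $L_{ij}=-1$ for adjacent $i\ne j$, $0$ otherwise. The Moore–Penrose pseudo-inverse of $L$ is the unique matrix $X$ with $LXL=L$, $XLX=X$, and $LX$, $XL$ symmetric. *)

theory Defs
  imports "HOL-Analysis.Analysis" "Graph_Theory.Digraph_Component"
begin

text \<open>
  A finite simple graph is a \<^locale>\<open>graph\<close> in the sense of the Graph Theory entry: a finite,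
  symmetric, loop-free digraph without parallel arcs. An undirected edge is a pair of opposite
  arcs, so the degree of a vertex is its out-degree. The vertex set is a whole finite type
  (\<open>verts G = UNIV\<close>), so that matrices indexed by the vertices are elements of \<open>real ^ 'n ^ 'n\<close>.
\<close>

definition regular_graph :: "nat \<Rightarrow> ('a, 'b) pre_digraph \<Rightarrow> bool" where
  "regular_graph d G \<longleftrightarrow> graph G \<and> (\<forall>v \<in> verts G. out_degree G v = d)"

definition laplacian :: "('n::finite, 'b) pre_digraph \<Rightarrow> real ^ 'n ^ 'n" where
  "laplacian G = (\<chi> i j. if i = j then real (out_degree G i)
                        else if (i, j) \<in> arcs_ends G then - 1 else 0)"

definition is_pseudo_inverse :: "real ^ 'n ^ 'n \<Rightarrow> real ^ 'n ^ 'n \<Rightarrow> bool" where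
  "is_pseudo_inverse A X \<longleftrightarrow>
     A ** X ** A = A \<and> X ** A ** X = X \<and>
     transpose (A ** X) = A ** X \<and> transpose (X ** A) = X ** A"

lemma is_pseudo_inverse_unique:
  assumes X: "is_pseudo_inverse A X" and Y: "is_pseudo_inverse A Y"
  shows "X = Y"
proof -
  have 1: "A ** X = A ** Y"
  proof -
    have "A ** X = transpose (A ** X)"
      using X by (simp add: is_pseudo_inverse_def)
    also have "\<dots> = transpose ((A ** Y) ** (A ** X))"
      using Y by (simp add: is_pseudo_inverse_def matrix_mul_assoc)
    also have "\<dots> = transpose (A ** X) ** transpose (A ** Y)"
      by (rule matrix_transpose_mul)
    also have "\<dots> = (A ** X) ** (A ** Y)"
      using X Y by (simp add: is_pseudo_inverse_def)
    also have "\<dots> = A ** Y"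
      using X by (simp add: is_pseudo_inverse_def matrix_mul_assoc)
    finally show ?thesis .
  qed
  have 2: "X ** A = Y ** A"
  proof -
    have "X ** A = transpose (X ** A)"
      using X by (simp add: is_pseudo_inverse_def)
    also have "\<dots> = transpose ((X ** A) ** (Y ** A))"
      using Y by (metis is_pseudo_inverse_def matrix_mul_assoc)
    also have "\<dots> = transpose (Y ** A) ** transpose (X ** A)"
      by (rule matrix_transpose_mul)
    also have "\<dots> = (Y ** A) ** (X ** A)"
      using X Y by (simp add: is_pseudo_inverse_def)
    also have "\<dots> = Y ** A"
      using X by (metis is_pseudo_inverse_def matrix_mul_assoc)
    finally show ?thesis .
  qed
  have "X = X ** A ** X" using X by (simp add: is_pseudo_inverse_def)
  also have "\<dots> = Y ** (A ** X)" by (simp add: 2 matrix_mul_assoc)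
  also have "\<dots> = Y" using Y by (simp add: 1 is_pseudo_inverse_def matrix_mul_assoc)
  finally show ?thesis .
qed

definition pseudo_inverse :: "real ^ 'n ^ 'n \<Rightarrow> real ^ 'n ^ 'n" where
  "pseudo_inverse A = (THE X. is_pseudo_inverse A X)"

definition max_diag :: "real ^ 'n ^ 'n \<Rightarrow> real" where
  "max_diag A = Max {A $ i $ i | i. True}"

text \<open>
  The inserted \<open>0\<close> only matters for 1-by-1 matrices, which have no off-diagonal entries;
  otherwise it does not change the maximum of absolute values.
\<close>

definition max_abs_offdiag :: "real ^ 'n ^ 'n \<Rightarrow> real" where
  "max_abs_offdiag A = Max (insert 0 {\<bar>A $ i $ j\<bar> | i j. i \<noteq> j})"

end

theory Submission
  imports Defs
begin

text \<open>
  Let \<open>x\<close> be column \<open>j\<close> of \<open>L\<^sup>\<dagger>\<close>, let \<open>C i\<close> be the set of the \<open>h = n - d - 1\<close> vertices outside the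
  closed neighbourhood of \<open>i\<close>, and let \<open>c\<close> bound the off-diagonal absolute values. Since \<open>x\<close> sums to
  zero, \<open>L L\<^sup>\<dagger> = I - J / n\<close> reads \<open>(d + 1) x i = - (\<Sum>k\<in>C i. x k) - 1 / n\<close> for \<open>i \<noteq> j\<close>. As \<open>x j \<ge> 0\<close>,
  this bounds every off-diagonal entry from above by \<open>(h c - 1 / n) / (d + 1)\<close>, which is smaller
  than \<open>c\<close>, so an extremal entry is negative. Feeding the upper bound back into the equation of an
  extremal entry gives \<open>c \<le> 1 / n\<^sup>2\<close> when \<open>i\<close> and \<open>j\<close> are adjacent and the claimed estimate otherwise.
\<close>

section \<open>Averaging projection and pseudo-inverses\<close>

lemma matrix_inv_mul:
  fixes A :: "real ^ 'n ^ 'n"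
  assumes "invertible A"
  shows "A ** matrix_inv A = mat 1" and "matrix_inv A ** A = mat 1"
  using someI_ex[OF assms[unfolded invertible_def]] unfolding matrix_inv_def by auto

lemma matrix_add_rdistrib: "((A :: real ^ 'n ^ 'm) + B) ** (C :: real ^ 'k ^ 'n) = A ** C + B ** C"
  by (simp add: matrix_matrix_mult_def vec_eq_iff algebra_simps sum.distrib)

lemma matrix_diff_rdistrib: "((A :: real ^ 'n ^ 'm) - B) ** (C :: real ^ 'k ^ 'n) = A ** C - B ** C"
  by (simp add: matrix_matrix_mult_def vec_eq_iff algebra_simps sum_subtractf)

lemma matrix_diff_ldistrib: "(A :: real ^ 'n ^ 'm) ** ((B :: real ^ 'k ^ 'n) - C) = A ** B - A ** C"
  by (simp add: matrix_matrix_mult_def vec_eq_iff algebra_simps sum_subtractf)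

text \<open>This is \<open>J / n\<close>, the orthogonal projection onto the constant
  vectors.\<close>

definition averaging :: "real ^ 'n ^ 'n" where
  "averaging = (\<chi> i j. 1 / real CARD('n))"

lemma averaging_mult_vec: "averaging *v v = (\<chi> i. (\<Sum>k\<in>UNIV. v $ k) / real CARD('n))"
  for v :: "real ^ 'n"
  by (simp add: averaging_def matrix_vector_mult_def sum_divide_distrib)

lemma averaging_idem: "averaging ** averaging = (averaging :: real ^ 'n ^ 'n)"
  by (simp add: averaging_def matrix_matrix_mult_def vec_eq_iff)

lemma transpose_averaging: "transpose averaging = averaging"
  by (simp add: averaging_def transpose_def vec_eq_iff)

lemma transpose_diff: "transpose (A - B) = transpose A - transpose (B :: real ^ 'n ^ 'm)"
  by (simp add: transpose_def vec_eq_iff)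

lemma pseudo_inverse_eqI: "is_pseudo_inverse A X \<Longrightarrow> pseudo_inverse A = X"
  unfolding pseudo_inverse_def by (blast intro: is_pseudo_inverse_unique)

text \<open>Adding the projection \<open>P = averaging\<close> repairs the kernel of
  \<open>L\<close>: \<open>M = L + P\<close> is invertible, and its inverse minus \<open>P\<close>
  satisfies the four Penrose conditions.\<close>

lemma pseudo_inverse_constant_kernel:
  fixes L :: "real ^ 'n ^ 'n"
  assumes LP: "L ** averaging = 0" and PL: "averaging ** L = 0"
    and ker: "\<And>v i j. L *v v = 0 \<Longrightarrow> v $ i = v $ j"
  shows "L ** pseudo_inverse L = mat 1 - averaging"
    and "averaging ** pseudo_inverse L = 0"
proof -
  let ?P = "averaging :: real ^ 'n ^ 'n"
  define M where "M = L + ?P"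
  have "v = 0" if v: "M *v v = 0" for v
  proof -
    \<comment> \<open>Since \<open>P ** L = 0\<close> and \<open>P ** P = P\<close>, applying
      \<open>P\<close> to \<open>M *v v = 0\<close> isolates \<open>P *v v\<close>.\<close>
    have "?P *v (M *v v) = (?P ** L + ?P ** ?P) *v v"
      by (simp add: M_def matrix_vector_mul_assoc matrix_add_ldistrib)
    then have Pv: "?P *v v = 0"
      using v by (simp add: PL averaging_idem)
    then have "L *v v = 0"
      using v by (simp add: M_def matrix_vector_mult_add_rdistrib)
    then have const: "v $ k = v $ i" for i k
      by (rule ker)
    have "v $ i = 0" for i
    proof -
      have "(\<Sum>k\<in>UNIV. v $ k) = (\<Sum>k\<in>(UNIV :: 'n set). v $ i)"
        by (rule sum.cong[OF refl const])
      then show ?thesis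
        using Pv by (simp add: averaging_mult_vec vec_eq_iff)
    qed
    then show ?thesis by (simp add: vec_eq_iff)
  qed
  then have "invertible M"
    by (simp add: invertible_left_inverse matrix_left_invertible_ker)
  note inv = matrix_inv_mul[OF this]
  define Y where "Y = matrix_inv M"
  have MP: "M ** ?P = ?P" and PM: "?P ** M = ?P"
    by (simp_all add: M_def matrix_add_rdistrib matrix_add_ldistrib LP PL averaging_idem)
  have YP: "Y ** ?P = ?P"
    by (metis MP Y_def inv(2) matrix_mul_assoc matrix_mul_lid)
  have PY: "?P ** Y = ?P"
    by (metis PM Y_def inv(1) matrix_mul_assoc matrix_mul_rid)
  define X where "X = Y - ?P"
  have L: "L = M - ?P" by (simp add: M_def)
  have LX: "L ** X = mat 1 - ?P"
    by (simp add: X_def L matrix_diff_rdistrib matrix_diff_ldistrib inv MP PY averaging_idem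
        flip: Y_def)
       (simp add: Y_def inv)
  have XL: "X ** L = mat 1 - ?P"
    by (simp add: X_def L matrix_diff_rdistrib matrix_diff_ldistrib inv PM YP averaging_idem
        flip: Y_def)
       (simp add: Y_def inv)
  have PX: "?P ** X = 0"
    by (simp add: X_def matrix_diff_ldistrib PY averaging_idem)
  have "is_pseudo_inverse L X"
    by (simp add: is_pseudo_inverse_def LX XL matrix_diff_rdistrib PL PX transpose_diff
        transpose_averaging transpose_mat)
  then have "pseudo_inverse L = X" by (rule pseudo_inverse_eqI)
  then show "L ** pseudo_inverse L = mat 1 - ?P" "?P ** pseudo_inverse L = 0"
    using LX PX by auto
qed

section \<open>Numerical estimates\<close>

text \<open>Multiplied by \<open>D\<close>, the last hypothesis becomes (D^2 - h^2) c \<le> (D - h)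
  / n. The positive factor \<open>D - h\<close> cancels and leaves \<open>D + h = n\<close>.\<close>

lemma column_estimate_diag_absent:
  fixes c D h n :: real
  assumes n: "n = D + h" and hD: "h < D" and h: "0 \<le> h"
    and c: "D * c \<le> h * ((h * c - 1 / n) / D) + 1 / n"
  shows "c \<le> 1 / n\<^sup>2"
proof -
  have pos: "D > 0" "n > 0" using assms by auto
  have "D * (D * c) \<le> D * (h * ((h * c - 1 / n) / D) + 1 / n)"
    using c pos by (intro mult_left_mono) auto
  also have "\<dots> = h * (h * c - 1 / n) + D / n"
    using pos by (simp add: field_simps)
  finally have "(D - h) * (n * c) \<le> (D - h) * (1 / n)"
    by (simp add: n algebra_simps diff_divide_distrib)
  then have "n * c \<le> 1 / n"
    using hD by (simp only: mult_le_cancel_left_pos)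
  then show ?thesis
    using pos by (simp add: field_simps power2_eq_square)
qed

text \<open>Here one of the \<open>h\<close> summands is the diagonal entry, estimated by
  \<open>f\<close>, and only the other \<open>h - 1\<close> obey the upper bound.\<close>

lemma column_estimate_diag_present:
  fixes c D h n f :: real
  assumes n: "n = D + h" and hD: "h + 1 \<le> D" and h: "1 \<le> h" and f: "0 \<le> f"
    and c: "D * c \<le> f + (h - 1) * ((h * c - 1 / n) / D) + 1 / n"
  shows "c \<le> f / (D - h + 1) + 2 / n\<^sup>2"
proof -
  have pos: "D > 0" "n > 0" using assms by auto
  define q where "q = D - h"
  have q: "1 \<le> q" "D = h + q" "n = 2 * h + q" using assms by (auto simp: q_def)
  \<comment> \<open>\<open>E\<close> is D^2 - h^2 + h, the coefficient of \<open>c\<close> once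
    \<open>D\<close> is cleared. Each term on the right is then compared with a multiple of
    \<open>E\<close>, so that \<open>E\<close> cancels.\<close>
  define E where "E = q * n + h"
  have E: "E > 0" using q h unfolding E_def q(3) by (intro add_nonneg_pos mult_nonneg_nonneg) auto
  have "D * (D * c) \<le> D * (f + (h - 1) * ((h * c - 1 / n) / D) + 1 / n)"
    using c pos by (intro mult_left_mono) auto
  also have "\<dots> = f * D + (h - 1) * (h * c - 1 / n) + D / n"
    using pos by (simp add: field_simps)
  finally have "E * c \<le> f * D + (q + 1) / n"
    by (simp add: E_def q_def n algebra_simps diff_divide_distrib add_divide_distrib)
  also have "f * D \<le> f * (E / (q + 1))"
  proof (rule mult_left_mono[OF _ f])
    \<comment> \<open>The difference E - D (q + 1) equals q (h - 1).\<close>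
    have "q \<le> h * q" using q h by simp
    then have "D * (q + 1) \<le> E" by (simp add: E_def q algebra_simps)
    then show "D \<le> E / (q + 1)" using q by (simp add: field_simps)
  qed
  also have "(q + 1) / n \<le> E * (2 / n\<^sup>2)"
  proof -
    have "n * (q + 1) \<le> 2 * E"
      using mult_left_mono[of 1 n q] q h by (simp add: E_def algebra_simps)
    then have "n * (q + 1) / n\<^sup>2 \<le> 2 * E / n\<^sup>2"
      by (rule divide_right_mono) simp
    then show ?thesis
      using pos by (simp add: power2_eq_square mult.commute)
  qed
  finally have "E * c \<le> E * (f / (q + 1) + 2 / n\<^sup>2)"
    by (simp add: algebra_simps)
  then show ?thesis
    using E by (simp only: mult_le_cancel_left_pos q_def)
qed

section \<open>Entries of one column\<close>

text \<open>Maximum principle: entries summing to zero have a maximum \<ge> 0, so if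
  \<open>x j < 0\<close> it sits at some \<open>k \<noteq> j\<close>. The equation there makes the
  sum over \<open>N k\<close> exceed \<open>d\<close> times the maximum.\<close>

lemma column_diag_nonneg:
  fixes N :: "'n::finite \<Rightarrow> 'n set" and x :: "'n \<Rightarrow> real" and d :: nat
  assumes N: "\<And>i. card (N i) = d"
    and sum0: "(\<Sum>k\<in>UNIV. x k) = 0"
    and eq: "\<And>i. i \<noteq> j \<Longrightarrow> real d * x i = (\<Sum>k\<in>N i. x k) - 1 / real CARD('n)"
  shows "0 \<le> x j"
proof (rule ccontr)
  assume neg: "\<not> 0 \<le> x j"
  have "Max (range x) \<in> range x" by (intro Max_in) auto
  then obtain k where k: "x k = Max (range x)" by (metis imageE)
  have max: "x l \<le> x k" for l by (simp add: k)
  have "0 \<le> x k"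
  proof (rule ccontr)
    assume "\<not> 0 \<le> x k"
    then have "x l < 0" for l using max[of l] by simp
    then have "(\<Sum>l\<in>UNIV. x l) < (\<Sum>l\<in>(UNIV :: 'n set). 0)" by (intro sum_strict_mono) auto
    then show False using sum0 by simp
  qed
  then have "k \<noteq> j" using neg by auto
  have "(\<Sum>l\<in>N k. x l) \<le> of_nat (card (N k)) * x k"
    by (rule sum_bounded_above) (rule max)
  then show False using eq[OF \<open>k \<noteq> j\<close>] by (simp add: N)
qed

text \<open>The graph enters only through its neighbour sets \<open>N i\<close>, and
  \<open>x\<close> plays column \<open>j\<close> of the pseudo-inverse. The two cases ask whether
  the diagonal entry \<open>x j\<close> occurs in the sum over \<open>C i\<close>.\<close>

lemma column_entry_bound:
  fixes N :: "'n::finite \<Rightarrow> 'n set" and x :: "'n \<Rightarrow> real" and d :: nat and c :: real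
  assumes N: "\<And>i. card (N i) = d" "\<And>i. i \<notin> N i"
    and d: "CARD('n) < 2 * d + 2"
    and sum0: "(\<Sum>k\<in>UNIV. x k) = 0"
    and eq: "\<And>i. i \<noteq> j \<Longrightarrow> real d * x i = (\<Sum>k\<in>N i. x k) - 1 / real CARD('n)"
    and le: "\<And>k. k \<noteq> j \<Longrightarrow> \<bar>x k\<bar> \<le> c"
    and i: "i \<noteq> j" "\<bar>x i\<bar> = c"
  shows "c \<le> x j / (2 * real d - real CARD('n) + 3) + 2 / (real CARD('n))\<^sup>2"
proof -
  define n where "n = real CARD('n)"
  have n: "n > 0" by (simp add: n_def)
  have xj: "0 \<le> x j"
    by (rule column_diag_nonneg[OF N(1) sum0 eq])
  define C where "C i = - insert i (N i)" for i
  define D where "D = real d + 1"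
  define h where "h = n - D"
  have card_C: "real (card (C i)) = h" for i
  proof -
    have "card (insert i (N i)) + card (C i) = CARD('n)"
      unfolding C_def by (metis card_Un_disjoint Compl_disjoint Compl_partition finite)
    then show ?thesis by (simp add: N h_def D_def n_def flip: of_nat_add)
  qed
  \<comment> \<open>Adding \<open>x i\<close> to both sides completes the sum to the closed
    neighbourhood; the zero total turns it into minus the sum over \<open>C i\<close>.\<close>
  have row: "D * x i = - (\<Sum>k\<in>C i. x k) - 1 / n" if "i \<noteq> j" for i
  proof -
    have "(\<Sum>k\<in>UNIV. x k) = (\<Sum>k\<in>insert i (N i). x k) + (\<Sum>k\<in>C i. x k)"
      unfolding C_def by (subst sum.union_disjoint[symmetric]) (auto simp: Compl_eq_Diff_UNIV)
    then show ?thesis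
      using eq[OF that] N(2) sum0 by (simp add: D_def n_def algebra_simps)
  qed
  have D: "h < D" "D > 0" "0 \<le> h" using d card_C[of i] by (auto simp: h_def D_def n_def)
  have "0 \<le> c" using i by auto
  have upper: "x k \<le> (h * c - 1 / n) / D" if "k \<noteq> j" for k
  proof -
    have "(\<Sum>l\<in>C k. - x l) \<le> of_nat (card (C k)) * c"
    proof (rule sum_bounded_above)
      \<comment> \<open>The diagonal entry may exceed \<open>c\<close>, but only its negative occurs
        here, and that is at most 0.\<close>
      fix l show "- x l \<le> c" using le[of l] xj \<open>0 \<le> c\<close> by (cases "l = j") auto
    qed
    then have "D * x k \<le> h * c - 1 / n"
      using row[OF that] by (simp add: card_C sum_negf)
    then show ?thesis using D by (simp add: field_simps)
  qed
  have xi: "x i = - c"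
  proof (rule ccontr)
    assume "x i \<noteq> - c"
    then have "x i = c" using i by auto
    then have "D * c \<le> h * c - 1 / n" using upper[OF i(1)] D by (simp add: field_simps)
    moreover have "h * c \<le> D * c" using D \<open>0 \<le> c\<close> by (intro mult_right_mono) auto
    moreover have "1 / n > 0" using n by simp
    ultimately show False by linarith
  qed
  have Dc: "D * c = (\<Sum>k\<in>C i. x k) + 1 / n" using row[OF i(1)] xi by simp
  have "c \<le> x j / (D - h + 1) + 2 / n\<^sup>2"
  proof (cases "j \<in> C i")
    case True
    then have "card (C i) \<ge> 1" by (auto simp: Suc_le_eq card_gt_0_iff)
    then have h1: "1 \<le> h" using card_C[of i] by linarith
    \<comment> \<open>Integrality sharpens \<open>h < D\<close> to a gap of one.\<close>
    have hD: "h + 1 \<le> D" using d by (simp add: h_def D_def n_def)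
    have "(\<Sum>k\<in>C i. x k) = x j + (\<Sum>k\<in>C i - {j}. x k)"
      using True by (simp add: sum.remove)
    also have "(\<Sum>k\<in>C i - {j}. x k) \<le> of_nat (card (C i - {j})) * ((h * c - 1 / n) / D)"
      by (rule sum_bounded_above) (use upper in auto)
    also have "of_nat (card (C i - {j})) = h - 1"
      using True card_C[of i] h1 by (simp add: of_nat_diff)
    finally show ?thesis
      using Dc by (intro column_estimate_diag_present h1 hD xj) (auto simp: h_def)
  next
    case False
    have "(\<Sum>k\<in>C i. x k) \<le> of_nat (card (C i)) * ((h * c - 1 / n) / D)"
      by (rule sum_bounded_above) (metis upper False)
    then have "c \<le> 1 / n\<^sup>2"
      using Dc D by (intro column_estimate_diag_absent[of n D h]) (auto simp: h_def card_C)
    moreover have "0 \<le> x j / (D - h + 1)" using xj D by auto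
    moreover have "1 / n\<^sup>2 \<le> 2 / n\<^sup>2" by (simp add: divide_right_mono)
    ultimately show ?thesis by linarith
  qed
  also have "D - h + 1 = 2 * real d - n + 3" by (simp add: h_def D_def)
  finally show "c \<le> x j / (2 * real d - real CARD('n) + 3) + 2 / (real CARD('n))\<^sup>2"
    by (simp only: n_def)
qed

section \<open>Laplacian of a dense regular graph\<close>

lemma regular_graph_neighbours:
  assumes "regular_graph d G" and "verts G = UNIV"
  shows "card {k. (i, k) \<in> arcs_ends G} = d" and "(i, i) \<notin> arcs_ends G"
    and "(i, k) \<in> arcs_ends G \<longleftrightarrow> (k, i) \<in> arcs_ends G"
proof -
  interpret graph G using assms by (simp add: regular_graph_def)
  have "{k. (i, k) \<in> arcs_ends G} = head G ` out_arcs G i"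
    by (auto simp: arcs_ends_conv out_arcs_def)
  \<comment> \<open>Without parallel arcs, counting outgoing arcs counts neighbours.\<close>
  moreover have "inj_on (head G) (out_arcs G i)"
    by (rule inj_onI) (auto intro!: no_multi_arcs simp: out_arcs_def arc_to_ends_def)
  ultimately show "card {k. (i, k) \<in> arcs_ends G} = d"
    using assms by (simp add: card_image regular_graph_def out_degree_def)
  show "(i, i) \<notin> arcs_ends G" using adj_not_same by blast
  show "(i, k) \<in> arcs_ends G \<longleftrightarrow> (k, i) \<in> arcs_ends G" using graph_symmetric by blast
qed

lemma laplacian_mult_vec:
  fixes G :: "('n::finite, 'b) pre_digraph"
  assumes "regular_graph d G" and "verts G = UNIV"
  shows "(laplacian G *v v) $ i = real d * v $ i - (\<Sum>k | (i, k) \<in> arcs_ends G. v $ k)"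
proof -
  have "(laplacian G *v v) $ i =
    (\<Sum>k\<in>UNIV. (if k = i then real d * v $ k else 0) - (if (i, k) \<in> arcs_ends G then v $ k else 0))"
    using assms regular_graph_neighbours(2)[OF assms]
    by (auto simp: laplacian_def matrix_vector_mult_def regular_graph_def intro!: sum.cong)
  then show ?thesis
    by (simp add: sum_subtractf flip: sum.inter_filter)
qed

text \<open>A maximum of a kernel vector spreads to its closed neighbourhood, and so does a minimum.
  Two closed neighbourhoods of size \<open>d + 1\<close> must meet when \<open>2 * d + 2\<close>
  exceeds the number of vertices, so maximum and minimum agree.\<close>

lemma laplacian_kernel:
  fixes G :: "('n::finite, 'b) pre_digraph"
  assumes G: "regular_graph d G" "verts G = UNIV" and d: "CARD('n) < 2 * d + 2"
    and v: "laplacian G *v v = 0"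
  shows "v $ i = v $ j"
proof -
  let ?N = "\<lambda>i. {k. (i, k) \<in> arcs_ends G}"
  note nb = regular_graph_neighbours[OF G]
  have eq: "(\<Sum>k\<in>?N i. v $ k) = real d * v $ i" for i
    using laplacian_mult_vec[OF G, of v i] v by simp
  have "Max (range (($) v)) \<in> range (($) v)" "Min (range (($) v)) \<in> range (($) v)"
    by (intro Max_in Min_in; simp)+
  then obtain a b where ab: "v $ a = Max (range (($) v))" "v $ b = Min (range (($) v))"
    by (metis imageE)
  have a: "v $ k \<le> v $ a" and b: "v $ b \<le> v $ k" for k
    by (simp_all add: ab)
  \<comment> \<open>Both sums have nonnegative terms, so each term vanishes.\<close>
  have "(\<Sum>k\<in>?N a. v $ a - v $ k) = 0" "(\<Sum>k\<in>?N b. v $ k - v $ b) = 0"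
    by (simp_all add: sum_subtractf eq nb(1))
  then have Na: "\<forall>k \<in> insert a (?N a). v $ k = v $ a" and Nb: "\<forall>k \<in> insert b (?N b). v $ k = v $ b"
    using a b by (simp_all add: sum_nonneg_eq_0_iff)
  have "insert a (?N a) \<inter> insert b (?N b) \<noteq> {}"
  proof
    assume "insert a (?N a) \<inter> insert b (?N b) = {}"
    then have "card (insert a (?N a) \<union> insert b (?N b)) = 2 * d + 2"
      by (subst card_Un_disjoint) (auto simp: nb(1,2))
    then show False
      using d card_mono[of UNIV "insert a (?N a) \<union> insert b (?N b)"] by simp
  qed
  then have "v $ a = v $ b" using Na Nb by (metis disjoint_iff)
  then show ?thesis using a b by (metis order_antisym order_trans)
qed

lemma laplacian_averaging:
  fixes G :: "('n::finite, 'b) pre_digraph"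
  assumes G: "regular_graph d G" "verts G = UNIV"
  shows "laplacian G ** averaging = 0" and "averaging ** laplacian G = 0"
proof -
  have sym: "transpose (laplacian G) = laplacian G"
    using regular_graph_neighbours(3)[OF G]
    by (auto simp: laplacian_def transpose_def vec_eq_iff)
  have "(laplacian G ** averaging) $ i $ j = 0" for i j
  proof -
    have "(laplacian G ** averaging) $ i $ j = (laplacian G *v (\<chi> k. 1 / real CARD('n))) $ i"
      by (simp add: matrix_matrix_mult_def matrix_vector_mult_def averaging_def)
    also have "\<dots> = 0"
      by (simp only: laplacian_mult_vec[OF G]) (simp add: regular_graph_neighbours(1)[OF G])
    finally show ?thesis .
  qed
  then show 0: "laplacian G ** averaging = 0" by (simp add: vec_eq_iff)
  \<comment> \<open>Both factors are symmetric, so the second product is the transpose of the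
    first.\<close>
  have "averaging ** laplacian G = transpose (laplacian G ** averaging)"
    by (simp add: matrix_transpose_mul sym transpose_averaging)
  then show "averaging ** laplacian G = 0"
    by (simp add: 0 transpose_def vec_eq_iff)
qed

section \<open>Bound for the off-diagonal entries\<close>

theorem mainTheorem6:
  fixes G :: "('n::finite, 'b) pre_digraph" and d n :: nat and f o' :: real
  assumes "verts G = UNIV"
    and "n = CARD('n)"
    and "regular_graph d G"
    and "Digraph_Component.connected G"
    and "real d > real n / 2 - 1"
    and "f = max_diag (pseudo_inverse (laplacian G))"
    and "o' = max_abs_offdiag (pseudo_inverse (laplacian G))"
  shows "o' \<le> f / (2 * real d - real n + 3) + 2 / (real n)\<^sup>2"
proof -
  note G = assms(3,1)
  note nb = regular_graph_neighbours[OF G]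
  have d: "CARD('n) < 2 * d + 2" using assms(2,5) by linarith
  define X where "X = pseudo_inverse (laplacian G)"
  have LX: "laplacian G ** X = mat 1 - averaging" and PX: "averaging ** X = 0"
    unfolding X_def
    using pseudo_inverse_constant_kernel[OF laplacian_averaging[OF G] laplacian_kernel[OF G d]]
    by auto
  have sum0: "(\<Sum>k\<in>UNIV. X $ k $ j) = 0" for j
  proof -
    have "(averaging ** X) $ j $ j = (\<Sum>k\<in>UNIV. X $ k $ j) / real CARD('n)"
      by (simp add: averaging_def matrix_matrix_mult_def sum_divide_distrib)
    then show ?thesis by (simp add: PX)
  qed
  \<comment> \<open>Off the diagonal, \<open>mat 1 - averaging\<close> has the entries -1 /
    n.\<close>
  have eq: "real d * X $ i $ j = (\<Sum>k | (i, k) \<in> arcs_ends G. X $ k $ j) - 1 / real CARD('n)"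
    if "i \<noteq> j" for i j
  proof -
    have "(laplacian G ** X) $ i $ j = (laplacian G *v column j X) $ i"
      by (simp add: matrix_matrix_mult_def matrix_vector_mult_def column_def)
    then show ?thesis
      using that by (simp add: laplacian_mult_vec[OF G] LX column_def mat_def averaging_def)
  qed
  have f: "X $ j $ j \<le> f" for j
    unfolding assms(6) max_diag_def X_def[symmetric] by (rule Max_ge[OF finite_image_set]) auto
  have "0 \<le> X $ j $ j" for j
    by (rule column_diag_nonneg[OF nb(1) sum0 eq])
  then have "0 \<le> f" using f by (metis order_trans)
  have den: "0 < 2 * real d - real n + 3" using assms(5) by linarith
  let ?O = "insert 0 {\<bar>X $ i $ j\<bar> | i j. i \<noteq> j}"
  have fin: "finite ?O"
    by (rule finite_subset[of _ "insert 0 ((\<lambda>(i, j). \<bar>X $ i $ j\<bar>) ` UNIV)"]) auto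
  have o': "o' = Max ?O"
    by (simp add: assms(7) max_abs_offdiag_def X_def)
  have "o' \<in> ?O" unfolding o' by (rule Max_in[OF fin]) simp
  then consider "o' = 0" | i j where "i \<noteq> j" "\<bar>X $ i $ j\<bar> = o'" by auto
  then show ?thesis
  proof cases
    \<comment> \<open>This covers a single vertex, where the maximum is the inserted 0; the
      right-hand side is nonnegative.\<close>
    case 1
    then show ?thesis using den \<open>0 \<le> f\<close> by simp
  next
    case 2
    have "\<bar>X $ k $ j\<bar> \<le> o'" if "k \<noteq> j" for k
      unfolding o' by (rule Max_ge[OF fin]) (use that in auto)
    \<comment> \<open>The global maximum \<open>o'\<close> bounds column \<open>j\<close> and is
      attained in it, so it can serve as \<open>c\<close>.\<close>
    from column_entry_bound[OF nb(1) _ d sum0 eq this 2]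
    have "o' \<le> X $ j $ j / (2 * real d - real n + 3) + 2 / (real n)\<^sup>2"
      using nb(2) by (simp add: assms(2))
    also have "X $ j $ j / (2 * real d - real n + 3) \<le> f / (2 * real d - real n + 3)"
      using den f by (simp add: divide_right_mono)
    finally show ?thesis by simp
  qed
qed

end
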